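(* Let $N\ge 1$ and let $q_i(t)\ge 0$, $i=1,\dots,N$, $t=0,1,2,\dots$, be backlogs evolving by $$q_i(t+1)=[q_i(t)+A_i(t)-s_i(t)]_+ ,$$ where $A_i(t)$ is the total arrival to, and $s_i(t)$ the total removal from, class $i$ on tick $t$. Assume $$0\le A_i(t)\le \bar A_i(t)\le \bar A_i^{\max}<\infty,\qquad 0\le s_i(t)\le \bar s_i<\infty$$ for all classes $i=1,\dots,N$ and all $t$. Fix thresholds $Q_i^{\mathrm{hi}}>0$ and margins $\varepsilon_i>0$, and suppose the executed action satisfies $$q_i(t)\ge Q_i^{\mathrm{hi}}\ \Rightarrow\ s_i(t)\ge \bar A_i(t)+\varepsilon_i\qquad \text{for all } i \text{ and all } t .$$ Let $\varepsilon_{\min}=\min_{1\le i\le N}\varepsilon_i$ and $B_0=\sum_{i=1}^N Q_i^{\mathrm{hi}}$, and define $$\widetilde K=\sum_{i=1}^N\bigl[2Q_i^{\mathrm{hi}}\bar A_i^{\max}+(\bar A_i^{\max}+\bar s_i)^2\bigr],\qquad \beta=2\varepsilon_{\min}B_0+\widetilde K .$$ Then, for all $t$, $$\mathbb{E}\left[V(q(t+1))-V(q(t))\mid q(t)\right]\le -2\varepsilon_{\min}\|q(t)\|_1+\beta ,$$ where $V(q)=\sum_{i=1}^N q_i^2$ and $\|q(t)\|_1=\sum_{i=1}^N q_i(t)$. In particular, $$\limsup_{T\to\infty}\frac1T\sum_{t=0}^{T-1}\mathbb{E}[\|q(t)\|_1]\le \frac{\beta}{2\varepsilon_{\min}} 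.$$
   Context: $[x]_+=\max\{x,0\}$. Time is slotted. $\bar A_i(t)$ is the declared arrival envelope of class $i$ on tick $t$; $\bar A_i^{\max}$, $\bar s_i$, $Q_i^{\mathrm{hi}}$, $\varepsilon_i$ are constants. The executed action determines the removals $s_i(t)$. Arrivals, removals and backlogs may be random, and expectations are over this randomness.
   Formalization: The time-average bound is proved under the added assumption that each initial backlog q_i(0) has finite expectation; without it the bound fails, because bounded removals keep E‖q(t)‖_1 infinite for all t. *)

theory Defs
  imports "HOL-Probability.Probability"
begin

text \<open>
  Classes are indexed by \<open>{1..N}\<close>; a backlog vector is a function \<open>nat \<Rightarrow> real\<close> of which only the
  entries in \<open>{1..N}\<close> matter.
\<close>

definition lyapunov :: "nat \<Rightarrow> (nat \<Rightarrow> real) \<Rightarrow> real" where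
  "lyapunov N x = (\<Sum>i = 1..N. (x i)\<^sup>2)"

text \<open>The 1-norm of a nonnegative vector.\<close>

definition total_backlog :: "nat \<Rightarrow> (nat \<Rightarrow> real) \<Rightarrow> real" where
  "total_backlog N x = (\<Sum>i = 1..N. x i)"

text \<open>
  The sub-sigma-algebra of \<open>M\<close> generated by the random vector \<open>(X \<omega> i)\<close>, \<open>i = 1..N\<close>.
\<close>

definition sigma_of_vector :: "'a measure \<Rightarrow> nat \<Rightarrow> ('a \<Rightarrow> nat \<Rightarrow> real) \<Rightarrow> 'a measure" where
  "sigma_of_vector M N X =
     vimage_algebra (space M) (\<lambda>\<omega>. restrict (X \<omega>) {1..N}) (\<Pi>\<^sub>M i\<in>{1..N}. borel)"

text \<open>
  The library's \<^const>\<open>real_cond_exp\<close> is the difference of the conditional expectations of the positive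
  and the negative part, so it is the usual (generalised) conditional expectation also for a
  non-integrable function whose positive and negative parts have almost surely finite conditional
  expectation. With bounded arrivals and removals, one-step increments of \<^const>\<open>lyapunov\<close>
  are bounded in absolute value by a function of the current backlog, hence are of this kind.
\<close>

definition cond_drift ::
  "'a measure \<Rightarrow> nat \<Rightarrow> (nat \<Rightarrow> 'a \<Rightarrow> nat \<Rightarrow> real) \<Rightarrow> nat \<Rightarrow> 'a \<Rightarrow> real" where
  "cond_drift M N q t =
     real_cond_exp M (sigma_of_vector M N (q t))
       (\<lambda>\<omega>. lyapunov N (q (t + 1) \<omega>) - lyapunov N (q t \<omega>))"

definition eps_min :: "nat \<Rightarrow> (nat \<Rightarrow> real) \<Rightarrow> real" where
  "eps_min N \<epsilon> = Min (\<epsilon> ` {1..N})"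

definition B0 :: "nat \<Rightarrow> (nat \<Rightarrow> real) \<Rightarrow> real" where
  "B0 N Qhi = (\<Sum>i = 1..N. Qhi i)"

definition K_tilde ::
  "nat \<Rightarrow> (nat \<Rightarrow> real) \<Rightarrow> (nat \<Rightarrow> real) \<Rightarrow> (nat \<Rightarrow> real) \<Rightarrow> real" where
  "K_tilde N Qhi Amax sbar = (\<Sum>i = 1..N. 2 * Qhi i * Amax i + (Amax i + sbar i)\<^sup>2)"

definition drift_const ::
  "nat \<Rightarrow> (nat \<Rightarrow> real) \<Rightarrow> (nat \<Rightarrow> real) \<Rightarrow> (nat \<Rightarrow> real) \<Rightarrow> (nat \<Rightarrow> real) \<Rightarrow> real" where
  "drift_const N Qhi \<epsilon> Amax sbar =
     2 * eps_min N \<epsilon> * B0 N Qhi + K_tilde N Qhi Amax sbar"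

end

theory Submission
  imports Defs
begin

text \<open>
  The drift bound holds pathwise: squaring the recursion gives
  \<open>q'\<^sup>2 - q\<^sup>2 \<le> 2 * q * (A - s) + (A - s)\<^sup>2\<close> in each class, where \<open>2 * q * (A - s) \<le> - 2 * \<epsilon> * q\<close> above the
  threshold and \<open>2 * q * (A - s) \<le> 2 * Qhi * Amax\<close> below it. As the bound depends on the current backlog
  only, it passes to the conditional expectation. Summing it along a path bounds the time
  average of the 1-norm by \<open>V (q 0) / (2 * \<epsilon> * T)\<close> plus the claimed constant. Since \<open>V (q 0)\<close> need not be
  integrable, expectations are taken by the reverse Fatou lemma, with the dominating function
  provided by \<open>q t i \<le> q 0 i + Qhi i + Amax i\<close>.
\<close>

text \<open>Monotonicity for an \<open>f\<close> that need not be integrable. The two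
  \<open>F\<close>-measurable bounds replace integrability: \<open>g\<close> keeps the conditional
  expectation of the positive part of \<open>f\<close> finite, and \<open>h\<close> does so for the
  negative part. The comparison itself is made between nonnegative conditional expectations.\<close>

lemma (in sigma_finite_subalgebra) real_cond_exp_le_of_lower_bound:
  fixes f g h :: "'a \<Rightarrow> real"
  assumes [measurable]: "f \<in> borel_measurable M"
    and gF [measurable]: "g \<in> borel_measurable F" and hF [measurable]: "h \<in> borel_measurable F"
    and fg: "AE x in M. f x \<le> g x" and hf: "AE x in M. - h x \<le> f x"
  shows "AE x in M. real_cond_exp M F f x \<le> g x"
proof -
  note [measurable] = measurable_from_subalg[OF subalg gF] measurable_from_subalg[OF subalg hF]
  let ?p = "nn_cond_exp M F (\<lambda>x. ennreal (f x))"
  let ?n = "nn_cond_exp M F (\<lambda>x. ennreal (- f x))"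
  have meas: "(\<lambda>x. ennreal (g x)) \<in> borel_measurable F" "(\<lambda>x. ennreal (- g x)) \<in> borel_measurable F"
    "(\<lambda>x. ennreal (h x)) \<in> borel_measurable F"
    by measurable
  have "AE x in M. ?p x \<le> nn_cond_exp M F (\<lambda>x. ennreal (g x)) x"
    using fg by (intro nn_cond_exp_mono) (auto intro: ennreal_leI)
  moreover have "AE x in M. ?n x \<le> nn_cond_exp M F (\<lambda>x. ennreal (h x)) x"
    using hf by (intro nn_cond_exp_mono) (auto intro!: ennreal_leI)
  \<comment> \<open>Subtraction-free form of the inequality between \<open>f\<close> and
    \<open>g\<close>: the negative parts are moved to the other side, so additivity of
    \<open>nn_cond_exp\<close> applies.\<close>
  moreover have "AE x in M. nn_cond_exp M F (\<lambda>x. ennreal (f x) + ennreal (- g x)) x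
      \<le> nn_cond_exp M F (\<lambda>x. ennreal (- f x) + ennreal (g x)) x"
  proof (intro nn_cond_exp_mono)
    have *: "ennreal a + ennreal (- b) \<le> ennreal (- a) + ennreal b" if "a \<le> b" for a b
      using that by (cases "a \<ge> 0"; cases "b \<ge> 0") (auto simp: ennreal_neg intro: ennreal_leI)
    show "AE x in M. ennreal (f x) + ennreal (- g x) \<le> ennreal (- f x) + ennreal (g x)"
      using fg by eventually_elim (rule *)
  qed auto
  moreover have "AE x in M. nn_cond_exp M F (\<lambda>x. ennreal (f x) + ennreal (- g x)) x
      = ?p x + nn_cond_exp M F (\<lambda>x. ennreal (- g x)) x"
    by (rule AE_symmetric, rule nn_cond_exp_sum) auto
  moreover have "AE x in M. nn_cond_exp M F (\<lambda>x. ennreal (- f x) + ennreal (g x)) x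
      = ?n x + nn_cond_exp M F (\<lambda>x. ennreal (g x)) x"
    by (rule AE_symmetric, rule nn_cond_exp_sum) auto
  moreover note nn_cond_exp_F_meas[OF meas(1)] nn_cond_exp_F_meas[OF meas(2)]
    nn_cond_exp_F_meas[OF meas(3)]
  ultimately show ?thesis
  proof eventually_elim
    case (elim x)
    have p: "?p x \<le> ennreal (g x)" and n: "?n x \<le> ennreal (h x)"
      and pn: "?p x + ennreal (- g x) \<le> ?n x + ennreal (g x)"
      using elim by simp_all
    \<comment> \<open>Finiteness matters: \<open>real_cond_exp\<close> passes through
      \<open>enn2real\<close>, which sends infinity to 0.\<close>
    obtain a where a: "?p x = ennreal a" "a \<ge> 0"
      using p by (cases "?p x") (auto simp: top_unique)
    obtain b where b: "?n x = ennreal b" "b \<ge> 0"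
      using n by (cases "?n x") (auto simp: top_unique)
    have "a - b \<le> g x"
      using pn p a(2) b(2) unfolding a(1) b(1)
      by (cases "g x \<ge> 0") (auto simp: ennreal_neg simp flip: ennreal_plus)
    then show ?case
      using a b by (simp add: real_cond_exp_def)
  qed
qed

lemma subalgebra_sigma_of_vector:
  assumes "\<And>i. i \<in> {1..N} \<Longrightarrow> (\<lambda>\<omega>. X \<omega> i) \<in> borel_measurable M"
  shows "subalgebra M (sigma_of_vector M N X)"
proof -
  have "(\<lambda>\<omega>. restrict (X \<omega>) {1..N}) \<in> measurable M (\<Pi>\<^sub>M i\<in>{1..N}. borel)"
    using assms by (intro measurable_restrict) auto
  then show ?thesis
    unfolding subalgebra_def sigma_of_vector_def
    by (simp add: sets_image_in_sets)
qed

lemma measurable_sigma_of_vector: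
  assumes "i \<in> {1..N}"
  shows "(\<lambda>\<omega>. X \<omega> i) \<in> borel_measurable (sigma_of_vector M N X)"
proof -
  have "(\<lambda>\<omega>. restrict (X \<omega>) {1..N}) \<in> measurable (sigma_of_vector M N X) (\<Pi>\<^sub>M i\<in>{1..N}. borel)"
    unfolding sigma_of_vector_def
    by (rule measurable_vimage_algebra1) (auto simp: space_PiM)
  from measurable_compose[OF this measurable_component_singleton[OF assms]] show ?thesis
    using assms by simp
qed

lemma class_drift_le:
  fixes q a s :: real
  assumes "0 \<le> q" "0 \<le> a" "a \<le> a'" "a' \<le> am" "0 \<le> s" "s \<le> sm" "0 < Q" "0 < e" "e \<le> \<epsilon>"
    and safe: "q \<ge> Q \<longrightarrow> s \<ge> a' + \<epsilon>"
  shows "(max (q + a - s) 0)\<^sup>2 - q\<^sup>2 \<le> - 2 * e * q + 2 * e * Q + (2 * Q * am + (am + sm)\<^sup>2)"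
proof -
  have "(max (q + a - s) 0)\<^sup>2 \<le> (q + a - s)\<^sup>2"
    by (auto simp: max_def)
  also have "\<dots> = q\<^sup>2 + 2 * (q * (a - s)) + (a - s)\<^sup>2"
    by (simp add: power2_eq_square algebra_simps)
  finally have 1: "(max (q + a - s) 0)\<^sup>2 \<le> q\<^sup>2 + 2 * (q * (a - s)) + (a - s)\<^sup>2" .
  have 2: "(a - s)\<^sup>2 \<le> (am + sm)\<^sup>2"
    using assms by (intro power2_le_iff_abs_le[THEN iffD2]) auto
  have 3: "q * (a - s) \<le> - (e * q) + e * Q + Q * am"
  proof (cases "q \<ge> Q")
    case True
    have "q * (a - s) \<le> q * (- e)"
      using True assms by (intro mult_left_mono) auto
    \<comment> \<open>The constants needed below the threshold are nonnegative and cost nothing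
      here.\<close>
    moreover have "0 \<le> e * Q" "0 \<le> Q * am"
      using assms by auto
    ultimately show ?thesis by (simp add: mult.commute)
  next
    case False
    have "q * (a - s) \<le> q * am"
      using assms by (intro mult_left_mono) auto
    also have "\<dots> \<le> Q * am"
      using False assms by (intro mult_right_mono) auto
    \<comment> \<open>Below the threshold \<open>e * (Q - q)\<close> is nonnegative, so it can be
      added to obtain the term \<open>- (e * q)\<close>. Summed over the classes, this is the origin
      of \<open>2 * eps_min * B0\<close>.\<close>
    finally show ?thesis
      using False mult_left_mono[of q Q e] assms by linarith
  qed
  show ?thesis using 1 2 3 by linarith
qed

lemma
  assumes "N \<ge> 1" "\<And>i. i \<in> {1..N} \<Longrightarrow> \<epsilon> i > 0"
  shows eps_min_pos: "eps_min N \<epsilon> > 0"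
    and eps_min_le: "i \<in> {1..N} \<Longrightarrow> eps_min N \<epsilon> \<le> \<epsilon> i"
  using assms by (auto simp: eps_min_def)

text \<open>Reverse Fatou under the dominating function \<open>w\<close>; as the total mass is 1,
  integrating the constant \<open>c\<close> returns \<open>c\<close>.\<close>

lemma limsup_nn_integral_le_const:
  fixes u :: "nat \<Rightarrow> 'a \<Rightarrow> ennreal"
  assumes "prob_space M" and [measurable]: "\<And>n. u n \<in> borel_measurable M" "w \<in> borel_measurable M"
    and "\<And>n. AE x in M. u n x \<le> w x" and "(\<integral>\<^sup>+x. w x \<partial>M) < \<infinity>"
    and lim: "AE x in M. limsup (\<lambda>n. u n x) \<le> c"
  shows "limsup (\<lambda>n. \<integral>\<^sup>+x. u n x \<partial>M) \<le> c"
proof -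
  interpret prob_space M by fact
  have "limsup (\<lambda>n. \<integral>\<^sup>+x. u n x \<partial>M) \<le> (\<integral>\<^sup>+x. limsup (\<lambda>n. u n x) \<partial>M)"
    using assms by (intro nn_integral_limsup[of _ _ w]) auto
  also have "\<dots> \<le> (\<integral>\<^sup>+x. c \<partial>M)"
    using lim by (rule nn_integral_mono_AE)
  also have "\<dots> = c"
    by (simp add: emeasure_space_1)
  finally show ?thesis .
qed

theorem theorem4:
  fixes M :: "'a measure"
    and N :: nat
    and q A s Abar :: "nat \<Rightarrow> 'a \<Rightarrow> nat \<Rightarrow> real"
    and Amax sbar Qhi \<epsilon> :: "nat \<Rightarrow> real"
  assumes "prob_space M"
    and "N \<ge> 1"
    and "\<And>t i. i \<in> {1..N} \<Longrightarrow> (\<lambda>\<omega>. q t \<omega> i) \<in> borel_measurable M"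
    and "\<And>t i. i \<in> {1..N} \<Longrightarrow> (\<lambda>\<omega>. A t \<omega> i) \<in> borel_measurable M"
    and "\<And>t i. i \<in> {1..N} \<Longrightarrow> (\<lambda>\<omega>. s t \<omega> i) \<in> borel_measurable M"
    and "\<And>t i. i \<in> {1..N} \<Longrightarrow> (\<lambda>\<omega>. Abar t \<omega> i) \<in> borel_measurable M"
    and "\<And>t i. i \<in> {1..N} \<Longrightarrow> AE \<omega> in M. 0 \<le> q t \<omega> i"
    and "\<And>t i. i \<in> {1..N} \<Longrightarrow>
           AE \<omega> in M. q (t + 1) \<omega> i = max (q t \<omega> i + A t \<omega> i - s t \<omega> i) 0"
    and "\<And>t i. i \<in> {1..N} \<Longrightarrow>
           AE \<omega> in M. 0 \<le> A t \<omega> i \<and> A t \<omega> i \<le> Abar t \<omega> i \<and> Abar t \<omega> i \<le> Amax i"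
    and "\<And>t i. i \<in> {1..N} \<Longrightarrow> AE \<omega> in M. 0 \<le> s t \<omega> i \<and> s t \<omega> i \<le> sbar i"
    and "\<And>i. i \<in> {1..N} \<Longrightarrow> Qhi i > 0"
    and "\<And>i. i \<in> {1..N} \<Longrightarrow> \<epsilon> i > 0"
    and "\<And>t i. i \<in> {1..N} \<Longrightarrow>
           AE \<omega> in M. q t \<omega> i \<ge> Qhi i \<longrightarrow> s t \<omega> i \<ge> Abar t \<omega> i + \<epsilon> i"
  shows "(\<forall>t. AE \<omega> in M. cond_drift M N q t \<omega>
              \<le> - 2 * eps_min N \<epsilon> * total_backlog N (q t \<omega>) + drift_const N Qhi \<epsilon> Amax sbar) \<and>
         ((\<forall>i\<in>{1..N}. integrable M (\<lambda>\<omega>. q 0 \<omega> i)) \<longrightarrow>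
            limsup (\<lambda>T. (\<Sum>t<T. \<integral>\<^sup>+\<omega>. ennreal (total_backlog N (q t \<omega>)) \<partial>M) / of_nat T)
              \<le> ennreal (drift_const N Qhi \<epsilon> Amax sbar / (2 * eps_min N \<epsilon>)))"
proof (intro conjI allI impI)
  interpret prob_space M by fact
  note [measurable] = assms(3-6)
  let ?I = "{1..N}"
  define e where "e = eps_min N \<epsilon>"
  define b where "b = drift_const N Qhi \<epsilon> Amax sbar"
  have e: "e > 0" "\<And>i. i \<in> ?I \<Longrightarrow> e \<le> \<epsilon> i"
    unfolding e_def using eps_min_pos eps_min_le assms(2,12) by blast+
  \<comment> \<open>Countably many almost sure conditions hold jointly off one null set, so whole
    paths can be treated deterministically.\<close>
  define good where "good = (\<lambda>\<omega>. \<forall>t. \<forall>i\<in>?I. 0 \<le> q t \<omega> i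
    \<and> q (t + 1) \<omega> i = max (q t \<omega> i + A t \<omega> i - s t \<omega> i) 0
    \<and> (0 \<le> A t \<omega> i \<and> A t \<omega> i \<le> Abar t \<omega> i \<and> Abar t \<omega> i \<le> Amax i)
    \<and> (0 \<le> s t \<omega> i \<and> s t \<omega> i \<le> sbar i)
    \<and> (q t \<omega> i \<ge> Qhi i \<longrightarrow> s t \<omega> i \<ge> Abar t \<omega> i + \<epsilon> i))"
  have good: "AE \<omega> in M. good \<omega>"
    unfolding good_def AE_all_countable
    using assms(7-10,13) by (intro allI AE_finite_allI AE_conjI) auto
  \<comment> \<open>A statement about constants that holds almost surely in a probability space
    holds outright.\<close>
  have Amax: "0 \<le> Amax i" if "i \<in> ?I" for i
  proof -
    have "AE \<omega> in M. 0 \<le> Amax i"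
      using assms(9)[OF that, of 0] by eventually_elim auto
    then show ?thesis by simp
  qed
  have drift: "lyapunov N (q (t + 1) \<omega>) - lyapunov N (q t \<omega>) \<le> - 2 * e * total_backlog N (q t \<omega>) + b"
    if "good \<omega>" for \<omega> t
  proof -
    have "lyapunov N (q (t + 1) \<omega>) - lyapunov N (q t \<omega>)
        = (\<Sum>i\<in>?I. (q (t + 1) \<omega> i)\<^sup>2 - (q t \<omega> i)\<^sup>2)"
      by (simp add: lyapunov_def sum_subtractf)
    also have "\<dots> \<le> (\<Sum>i\<in>?I. - 2 * e * q t \<omega> i + 2 * e * Qhi i
        + (2 * Qhi i * Amax i + (Amax i + sbar i)\<^sup>2))"
    proof (rule sum_mono)
      fix i assume i: "i \<in> ?I"
      have eq: "q (t + 1) \<omega> i = max (q t \<omega> i + A t \<omega> i - s t \<omega> i) 0"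
        using that i unfolding good_def by blast
      show "(q (t + 1) \<omega> i)\<^sup>2 - (q t \<omega> i)\<^sup>2
          \<le> - 2 * e * q t \<omega> i + 2 * e * Qhi i + (2 * Qhi i * Amax i + (Amax i + sbar i)\<^sup>2)"
        unfolding eq
        by (rule class_drift_le[where a' = "Abar t \<omega> i" and \<epsilon> = "\<epsilon> i"])
           (use that i e assms(11) in \<open>auto simp: good_def\<close>)
    qed
    also have "\<dots> = - 2 * e * total_backlog N (q t \<omega>) + b"
      by (simp add: b_def drift_const_def B0_def K_tilde_def total_backlog_def sum.distrib
          sum_subtractf sum_negf sum_distrib_left e_def)
    finally show ?thesis .
  qed
  have V: "0 \<le> lyapunov N x" for x
    by (simp add: lyapunov_def sum_nonneg)
  have [measurable]: "(\<lambda>\<omega>. total_backlog N (q t \<omega>)) \<in> borel_measurable M"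
    "(\<lambda>\<omega>. lyapunov N (q t \<omega>)) \<in> borel_measurable M" for t
    unfolding total_backlog_def lyapunov_def by measurable

  show "AE \<omega> in M. cond_drift M N q t \<omega>
      \<le> - 2 * eps_min N \<epsilon> * total_backlog N (q t \<omega>) + drift_const N Qhi \<epsilon> Amax sbar" for t
  proof -
    let ?F = "sigma_of_vector M N (q t)"
    have "subalgebra M ?F"
      by (rule subalgebra_sigma_of_vector) (fact assms(3))
    then interpret finite_measure_subalgebra M ?F
      by unfold_locales
    note [measurable] = measurable_sigma_of_vector
    show ?thesis
      unfolding cond_drift_def e_def[symmetric] b_def[symmetric]
    proof (rule real_cond_exp_le_of_lower_bound)
      show "(\<lambda>\<omega>. - 2 * e * total_backlog N (q t \<omega>) + b) \<in> borel_measurable ?F"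
        "(\<lambda>\<omega>. lyapunov N (q t \<omega>)) \<in> borel_measurable ?F"
        unfolding total_backlog_def lyapunov_def by measurable
      show "AE \<omega> in M. lyapunov N (q (t + 1) \<omega>) - lyapunov N (q t \<omega>)
          \<le> - 2 * e * total_backlog N (q t \<omega>) + b"
        using good by eventually_elim (rule drift)
      \<comment> \<open>The next value of \<open>lyapunov\<close> is nonnegative, so the increment
        is bounded below by a function of the current backlog.\<close>
      show "AE \<omega> in M. - lyapunov N (q t \<omega>) \<le> lyapunov N (q (t + 1) \<omega>) - lyapunov N (q t \<omega>)"
        using V by (auto simp: algebra_simps)
    qed measurable
  qed

  assume int: "\<forall>i\<in>?I. integrable M (\<lambda>\<omega>. q 0 \<omega> i)"
  define W where "W = (\<lambda>\<omega>. \<Sum>i\<in>?I. q 0 \<omega> i + (Qhi i + Amax i))"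
  have nonneg: "0 \<le> total_backlog N (q t \<omega>)" if "good \<omega>" for t \<omega>
    using that by (auto simp: total_backlog_def good_def intro!: sum_nonneg)
  have le_W: "total_backlog N (q t \<omega>) \<le> W \<omega>" if "good \<omega>" for t \<omega>
    unfolding total_backlog_def W_def
  proof (rule sum_mono)
    fix i assume i: "i \<in> ?I"
    \<comment> \<open>At or above the threshold removals exceed arrivals and the backlog cannot
      grow; below it, one tick leads at most to \<open>Qhi i + Amax i\<close>. The initial backlog
      is kept because it may start higher.\<close>
    show "q t \<omega> i \<le> q 0 \<omega> i + (Qhi i + Amax i)"
    proof (induction t)
      case 0
      show ?case using assms(11)[OF i] Amax[OF i] by simp
    next
      case (Suc t)
      have "0 \<le> q 0 \<omega> i" "0 \<le> q t \<omega> i" "q (Suc t) \<omega> i = max (q t \<omega> i + A t \<omega> i - s t \<omega> i) 0"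
        "A t \<omega> i \<le> Abar t \<omega> i" "Abar t \<omega> i \<le> Amax i" "0 \<le> s t \<omega> i"
        "q t \<omega> i \<ge> Qhi i \<longrightarrow> s t \<omega> i \<ge> Abar t \<omega> i + \<epsilon> i"
        using that i unfolding good_def by (metis Suc_eq_plus1)+
      then show ?case
        using Suc.IH assms(12)[OF i] by linarith
    qed
  qed
  have sum_le: "2 * e * (\<Sum>t<T. total_backlog N (q t \<omega>)) \<le> lyapunov N (q 0 \<omega>) + real T * b"
    if "good \<omega>" for T \<omega>
  proof -
    \<comment> \<open>The current \<open>lyapunov\<close> value is carried along to make the
      induction telescope, and dropped afterwards by nonnegativity.\<close>
    have "lyapunov N (q T \<omega>) + 2 * e * (\<Sum>t<T. total_backlog N (q t \<omega>))
        \<le> lyapunov N (q 0 \<omega>) + real T * b"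
    proof (induction T)
      case (Suc T)
      then show ?case using drift[OF that, of T] by (simp add: algebra_simps)
    qed simp
    then show ?thesis using V[of "q T \<omega>"] by linarith
  qed
  \<comment> \<open>Averages are taken in \<open>ennreal\<close>, where the integral commutes with
    the finite sum by measurability alone.\<close>
  define u where "u = (\<lambda>T \<omega>. (\<Sum>t<T. ennreal (total_backlog N (q t \<omega>))) / of_nat T)"
  have u_eq: "u T \<omega> = ennreal ((\<Sum>t<T. total_backlog N (q t \<omega>)) / real T)"
    if "good \<omega>" "T > 0" for T \<omega>
    using that nonneg by (simp add: u_def sum_ennreal divide_ennreal sum_nonneg
        ennreal_of_nat_eq_real_of_nat)
  have [measurable]: "u T \<in> borel_measurable M" for T
    unfolding u_def by measurable
  have "limsup (\<lambda>T. \<integral>\<^sup>+\<omega>. u T \<omega> \<partial>M) \<le> ennreal (b / (2 * e))"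
  proof (rule limsup_nn_integral_le_const[where w = "\<lambda>\<omega>. ennreal (W \<omega>)"])
    have W: "integrable M W"
      unfolding W_def using int by auto
    then show "(\<lambda>\<omega>. ennreal (W \<omega>)) \<in> borel_measurable M"
      by measurable
    have "(\<integral>\<^sup>+\<omega>. ennreal (W \<omega>) \<partial>M) \<le> (\<integral>\<^sup>+\<omega>. ennreal (norm (W \<omega>)) \<partial>M)"
      by (intro nn_integral_mono ennreal_leI) auto
    also have "\<dots> < \<infinity>"
      using W by (simp add: integrable_iff_bounded)
    finally show "(\<integral>\<^sup>+\<omega>. ennreal (W \<omega>) \<partial>M) < \<infinity>" .
    show "AE \<omega> in M. u T \<omega> \<le> ennreal (W \<omega>)" for T
      using good
    proof eventually_elim
      case (elim \<omega>)
      show ?case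
      \<comment> \<open>At \<open>T = 0\<close> the empty average is \<open>0 / 0\<close>, which is
        0 in \<open>ennreal\<close>.\<close>
      proof (cases "T = 0")
        case False
        have "(\<Sum>t<T. total_backlog N (q t \<omega>)) \<le> real T * W \<omega>"
          using sum_bounded_above[of "{..<T}" "\<lambda>t. total_backlog N (q t \<omega>)" "W \<omega>"] le_W[OF elim]
          by simp
        then show ?thesis
          using False elim by (simp add: u_eq ennreal_leI field_simps)
      qed (simp add: u_def)
    qed
    show "AE \<omega> in M. limsup (\<lambda>T. u T \<omega>) \<le> ennreal (b / (2 * e))"
      using good
    proof eventually_elim
      case (elim \<omega>)
      \<comment> \<open>On a fixed path the initial \<open>lyapunov\<close> value is a finite
        number, so its share vanishes after division by \<open>T\<close>, whether or not it is
        integrable over paths.\<close>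
      define r where "r = (\<lambda>T. lyapunov N (q 0 \<omega>) / (2 * e) / real T + b / (2 * e))"
      have "u T \<omega> \<le> ennreal (r T)" if "T > 0" for T
        using sum_le[OF elim, of T] that elim e(1)
        by (simp add: u_eq r_def ennreal_leI field_simps)
      then have "limsup (\<lambda>T. u T \<omega>) \<le> limsup (\<lambda>T. ennreal (r T))"
        by (intro Limsup_mono eventually_mono[OF eventually_gt_at_top[of 0]]) auto
      also have "r \<longlonglongrightarrow> 0 + b / (2 * e)"
        unfolding r_def by (intro tendsto_add tendsto_const lim_const_over_n)
      then have "limsup (\<lambda>T. ennreal (r T)) = ennreal (b / (2 * e))"
        by (intro lim_imp_Limsup tendsto_ennrealI) auto
      finally show ?case .
    qed
  qed (fact assms(1), measurable)
  moreover have "(\<integral>\<^sup>+\<omega>. u T \<omega> \<partial>M) = (\<Sum>t<T. \<integral>\<^sup>+\<omega>. ennreal (total_backlog N (q t \<omega>)) \<partial>M) / of_nat T" for T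
    unfolding u_def by (simp add: nn_integral_divide nn_integral_sum)
  ultimately show "limsup (\<lambda>T. (\<Sum>t<T. \<integral>\<^sup>+\<omega>. ennreal (total_backlog N (q t \<omega>)) \<partial>M) / of_nat T)
      \<le> ennreal (drift_const N Qhi \<epsilon> Amax sbar / (2 * eps_min N \<epsilon>))"
    by (simp add: b_def e_def)
qed

end
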